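(* Suppose that $w$ is a recurrent infinite pin word. Then the centred pin class $\mathcal{C}^{\circ}_{w}$ is $\boxplus$-closed.
   Context: **Centred permutations.** A centred permutation of length $n$ is a permutation of length $n+1$ with one entry designated as the origin (not counted in the length); equivalently a finite set of points in the plane, no two sharing an $x$- or $y$-coordinate, one designated as origin, up to order-isomorphism in each coordinate. The origin splits the plane into quadrants $1,2,3,4$, anticlockwise from the top right. $\pi^\circ\le\sigma^\circ$ means $\pi^\circ$ embeds order-isomorphically in $\sigma^\circ$ with origin mapped to origin. **Box sum.** $\pi^\circ\boxplus\sigma^\circ$ is obtained by inflating the origin of $\sigma^\circ$ by a copy of $\pi^\circ$ (whose origin becomes the new origin). A set of centred permutations closed downwards under $\le$ is $\boxplus$-closed if it is closed under $\boxplus$. **Pin words.** A finite pin word is a word whose first letter is in $\{1,2,3,4\}$, whose other letters are in $\{u,d,l,r\}$, and in which no two consecutive letters are both in $\{u,d\}$ or both in $\{l,r\}$. An infinite pin word is an infinite word all of whose finite non-empty prefixes are finite pin words. A finite pin word $w$ of length $n$ generates a centred permutation $\pi^\circ_w$ of length $n$: place an origin $p_0$; place $p_1$ in the quadrant given by the initial numeral; for $k\ge 2$ place $p_k$ beyond all of $p_0,\dots,p_{k-1}$ in the direction (up, down, left, right) given by the $k$th letter, with its other coordinate strictly separating $p_{k-1}$ from all of $p_0,\dots,p_{k-2}$. **Pin classes.** For an infinite pin word $w$, $\mathcal{C}^\circ_w$ is the set of centred permutations contained in $\pi^\circ_v$ for some finite prefix $v$ of $w$. **Recurrence.** For $i\le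 j$, $w_{i,j}$ is the subword of $w$ in positions $i,\dots,j$, with (if $i\ge2$) its first letter replaced by the numeral of the quadrant containing $p_i$; these are the pin factors of $w$. An infinite pin word $w$ is recurrent if every pin factor of $w$ equals $w_{i,j}$ for infinitely many pairs $(i,j)$. *)

theory Defs
  imports Complex_Main
begin

section \<open>Centred permutations\<close>

text \<open>
  A centred permutation of length n is a list enumerating 0, \<dots>, n (the underlying permutation
  of length n + 1 in one-line notation) together with the index of the entry that is its origin.
\<close>

typedef centred_perm =
  "{(xs :: nat list, c :: nat). distinct xs \<and> set xs = {..<length xs} \<and> c < length xs}"
  by (rule exI[of _ "([0], 0)"]) auto

setup_lifting type_definition_centred_perm

lift_definition entries :: "centred_perm \<Rightarrow> nat list" is fst .

lift_definition origin :: "centred_perm \<Rightarrow> nat" is snd .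

lemma distinct_entries: "distinct (entries \<pi>)"
  and set_entries: "set (entries \<pi>) = {..<length (entries \<pi>)}"
  and origin_less: "origin \<pi> < length (entries \<pi>)"
  using Rep_centred_perm[of \<pi>] by (simp_all add: entries.rep_eq origin.rep_eq split_beta)

lemma centred_perm_eqI: "entries \<pi> = entries \<sigma> \<Longrightarrow> origin \<pi> = origin \<sigma> \<Longrightarrow> \<pi> = \<sigma>"
  by (simp add: entries.rep_eq origin.rep_eq prod_eq_iff flip: Rep_centred_perm_inject)

definition cp_length :: "centred_perm \<Rightarrow> nat" where
  "cp_length \<pi> = length (entries \<pi>) - 1"

definition contained :: "centred_perm \<Rightarrow> centred_perm \<Rightarrow> bool"  (infix "\<preceq>" 50) where
  "\<pi> \<preceq> \<sigma> \<longleftrightarrow>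
     (\<exists>f. strict_mono_on {..<length (entries \<pi>)} f \<and>
          f ` {..<length (entries \<pi>)} \<subseteq> {..<length (entries \<sigma>)} \<and>
          (\<forall>i < length (entries \<pi>). \<forall>j < length (entries \<pi>).
             entries \<pi> ! i < entries \<pi> ! j \<longleftrightarrow> entries \<sigma> ! f i < entries \<sigma> ! f j) \<and>
          f (origin \<pi>) = origin \<sigma>)"

text \<open>
  In the box sum the origin of the second summand, with value v, is replaced by a block of
  consecutive positions and values order-isomorphic to the first summand: the entries of the first
  summand are raised by v, and the entries of the second summand exceeding v make room for the m
  values of the block by moving up by m - 1.
\<close>

lift_definition box_sum :: "centred_perm \<Rightarrow> centred_perm \<Rightarrow> centred_perm"  (infixl "\<boxplus>" 65)
  is "\<lambda>(xs, a) (ys, b).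
        let m = length xs; v = ys ! b; g = (\<lambda>y. if v < y then y + (m - 1) else y)
        in (map g (take b ys) @ map (\<lambda>x. x + v) xs @ map g (drop (Suc b) ys), b + a)"
  subgoal premises prems for P Q
  proof -
    note prems
    moreover obtain xs a where P: "P = (xs, a)" by (cases P)
    moreover obtain ys b where Q: "Q = (ys, b)" by (cases Q)
    ultimately have xs: "distinct xs" "set xs = {..<length xs}" "a < length xs"
      and ys: "distinct ys" "set ys = {..<length ys}" "b < length ys" by auto
    define m v where "m = length xs" and "v = ys ! b"
    define g where "g = (\<lambda>y. if v < y then y + (m - 1) else y)"
    define zs where "zs = map g (take b ys) @ map (\<lambda>x. x + v) xs @ map g (drop (Suc b) ys)"
    have split: "ys = take b ys @ v # drop (Suc b) ys"
      unfolding v_def using ys(3) by (rule id_take_nth_drop)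
    have "distinct (take b ys @ v # drop (Suc b) ys)" "set (take b ys @ v # drop (Suc b) ys) = set ys"
      using ys(1) split by metis+
    hence others: "set (take b ys) \<union> set (drop (Suc b) ys) = {..<length ys} - {v}"
      using ys(2) by auto
    have m: "m > 0" using xs(3) by (auto simp: m_def)
    have v: "v < length ys" using ys by (metis v_def lessThan_iff nth_mem)
    have len: "length zs = length ys + (m - 1)"
      using ys(3) m by (simp add: zs_def flip: m_def)
    have "set zs = g ` ({..<length ys} - {v}) \<union> (\<lambda>x. x + v) ` {..<m}"
      unfolding zs_def others[symmetric] using xs(2) by (auto simp: m_def)
    also have "\<dots> = {..<length zs}"
    proof (intro equalityI subsetI)
      fix z assume "z \<in> {..<length zs}"
      hence z: "z < length ys + (m - 1)" by (simp add: len)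
      consider "z < v" | "v \<le> z" "z < v + m" | "v + m \<le> z" by linarith
      thus "z \<in> g ` ({..<length ys} - {v}) \<union> (\<lambda>x. x + v) ` {..<m}"
      proof cases
        case 1
        hence "z = g z" "z \<in> {..<length ys} - {v}" using v by (auto simp: g_def)
        thus ?thesis by blast
      next
        case 2
        hence "z = (z - v) + v" "z - v \<in> {..<m}" by auto
        thus ?thesis by blast
      next
        case 3
        hence "z = g (z - (m - 1))" "z - (m - 1) \<in> {..<length ys} - {v}"
          using m z by (auto simp: g_def)
        thus ?thesis by blast
      qed
    next
      fix z assume "z \<in> g ` ({..<length ys} - {v}) \<union> (\<lambda>x. x + v) ` {..<m}"
      then consider y where "z = g y" "y < length ys" "y \<noteq> v" | x where "z = x + v" "x < m" by auto
      thus "z \<in> {..<length zs}"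
      proof cases
        case (1 y)
        thus ?thesis using m unfolding len g_def by (cases "v < y") auto
      next
        case (2 x)
        thus ?thesis using m v unfolding len by simp
      qed
    qed
    finally have set: "set zs = {..<length zs}" .
    hence "distinct zs" by (intro card_distinct) simp
    moreover have "b + a < length zs" using len xs(3) ys(3) by (auto simp: m_def)
    ultimately show ?thesis
      using set unfolding P Q zs_def g_def m_def v_def by (simp add: Let_def)
  qed
  done

definition downward_closed :: "centred_perm set \<Rightarrow> bool" where
  "downward_closed C \<longleftrightarrow> (\<forall>\<sigma> \<in> C. \<forall>\<pi>. \<pi> \<preceq> \<sigma> \<longrightarrow> \<pi> \<in> C)"

definition box_closed :: "centred_perm set \<Rightarrow> bool" where
  "box_closed C \<longleftrightarrow> downward_closed C \<and> (\<forall>\<pi> \<in> C. \<forall>\<sigma> \<in> C. \<pi> \<boxplus> \<sigma> \<in> C)"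

text \<open>
  The centred permutation \<open>\<pi>\<close> is the order-isomorphism type of the finite set \<open>S\<close> of points in the
  plane, with the point \<open>o'\<close> of \<open>S\<close> as its origin.
\<close>

definition represents :: "centred_perm \<Rightarrow> (real \<times> real) set \<Rightarrow> real \<times> real \<Rightarrow> bool" where
  "represents \<pi> S o' \<longleftrightarrow>
     (\<exists>f. bij_betw f {..<length (entries \<pi>)} S \<and>
          (\<forall>i < length (entries \<pi>). \<forall>j < length (entries \<pi>).
             (i < j \<longleftrightarrow> fst (f i) < fst (f j)) \<and>
             (entries \<pi> ! i < entries \<pi> ! j \<longleftrightarrow> snd (f i) < snd (f j))) \<and>
          f (origin \<pi>) = o')"


section \<open>Pin words\<close>

datatype direction = Up | Down | Left | Right

text \<open>The quadrants are numbered anticlockwise from the top right.\<close>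

datatype quadrant = Q1 | Q2 | Q3 | Q4

datatype letter = Num quadrant | Dir direction

definition same_axis :: "direction \<Rightarrow> direction \<Rightarrow> bool" where
  "same_axis a b \<longleftrightarrow> {a, b} \<subseteq> {Up, Down} \<or> {a, b} \<subseteq> {Left, Right}"

definition finite_pin_word :: "letter list \<Rightarrow> bool" where
  "finite_pin_word w \<longleftrightarrow>
     w \<noteq> [] \<and> (\<exists>q. w ! 0 = Num q) \<and>
     (\<forall>k. 1 \<le> k \<and> k < length w \<longrightarrow> (\<exists>d. w ! k = Dir d)) \<and>
     (\<forall>k a b. Suc k < length w \<and> w ! k = Dir a \<and> w ! Suc k = Dir b \<longrightarrow> \<not> same_axis a b)"

text \<open>In an infinite word \<open>w\<close>, the letter in position k, counted from 1, is \<open>w (k - 1)\<close>.\<close>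

definition word_prefix :: "(nat \<Rightarrow> letter) \<Rightarrow> nat \<Rightarrow> letter list" where
  "word_prefix w n = map w [0..<n]"

definition infinite_pin_word :: "(nat \<Rightarrow> letter) \<Rightarrow> bool" where
  "infinite_pin_word w \<longleftrightarrow> (\<forall>n \<ge> 1. finite_pin_word (word_prefix w n))"

fun in_quadrant :: "quadrant \<Rightarrow> real \<times> real \<Rightarrow> real \<times> real \<Rightarrow> bool" where
  "in_quadrant Q1 o' p \<longleftrightarrow> fst o' < fst p \<and> snd o' < snd p"
| "in_quadrant Q2 o' p \<longleftrightarrow> fst p < fst o' \<and> snd o' < snd p"
| "in_quadrant Q3 o' p \<longleftrightarrow> fst p < fst o' \<and> snd p < snd o'"
| "in_quadrant Q4 o' p \<longleftrightarrow> fst o' < fst p \<and> snd p < snd o'"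

fun beyond :: "direction \<Rightarrow> real \<times> real \<Rightarrow> real \<times> real \<Rightarrow> bool" where
  "beyond Up p s \<longleftrightarrow> snd s < snd p"
| "beyond Down p s \<longleftrightarrow> snd p < snd s"
| "beyond Right p s \<longleftrightarrow> fst s < fst p"
| "beyond Left p s \<longleftrightarrow> fst p < fst s"

fun other_coord :: "direction \<Rightarrow> real \<times> real \<Rightarrow> real" where
  "other_coord Up p = fst p"
| "other_coord Down p = fst p"
| "other_coord Left p = snd p"
| "other_coord Right p = snd p"

definition separates :: "real \<Rightarrow> real \<Rightarrow> real set \<Rightarrow> bool" where
  "separates x y T \<longleftrightarrow> (\<forall>t \<in> T. t < x) \<and> x < y \<or> (\<forall>t \<in> T. x < t) \<and> y < x"

definition pin_sequence :: "letter list \<Rightarrow> (nat \<Rightarrow> real \<times> real) \<Rightarrow> bool" where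
  "pin_sequence w p \<longleftrightarrow>
     (\<exists>q. w ! 0 = Num q \<and> in_quadrant q (p 0) (p 1)) \<and>
     (\<forall>k. 2 \<le> k \<and> k \<le> length w \<longrightarrow>
        (\<exists>d. w ! (k - 1) = Dir d \<and>
             (\<forall>i < k. beyond d (p k) (p i)) \<and>
             separates (other_coord d (p k)) (other_coord d (p (k - 1)))
                       ((\<lambda>i. other_coord d (p i)) ` {..<k - 1})))"

text \<open>
  The definite descriptions below are justified for pin words by the theorems
  \<open>ex1_pin_perm\<close> and \<open>ex1_pin_quadrant\<close>.
\<close>

definition pin_perm :: "letter list \<Rightarrow> centred_perm" where
  "pin_perm w = (THE \<pi>. \<exists>p. pin_sequence w p \<and> represents \<pi> (p ` {..length w}) (p 0))"

definition pin_quadrant :: "(nat \<Rightarrow> letter) \<Rightarrow> nat \<Rightarrow> quadrant" where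
  "pin_quadrant w i = (THE q. \<exists>p. pin_sequence (word_prefix w i) p \<and> in_quadrant q (p 0) (p i))"

definition centred_pin_class :: "(nat \<Rightarrow> letter) \<Rightarrow> centred_perm set" where
  "centred_pin_class w = {\<pi>. \<exists>n \<ge> 1. \<pi> \<preceq> pin_perm (word_prefix w n)}"

definition pin_factor :: "(nat \<Rightarrow> letter) \<Rightarrow> nat \<Rightarrow> nat \<Rightarrow> letter list" where
  "pin_factor w i j =
     (if 2 \<le> i then Num (pin_quadrant w i) # map w [i..<j] else map w [i - 1..<j])"

definition recurrent :: "(nat \<Rightarrow> letter) \<Rightarrow> bool" where
  "recurrent w \<longleftrightarrow>
     (\<forall>i j. 1 \<le> i \<and> i \<le> j \<longrightarrow>
        infinite {(i', j'). 1 \<le> i' \<and> i' \<le> j' \<and> pin_factor w i' j' = pin_factor w i j})"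


section \<open>Well-definedness\<close>

subsection \<open>Order types\<close>

lemma represents_ranks:
  assumes bij: "bij_betw f {..<length (entries \<pi>)} S"
    and ord: "\<And>i j. i < length (entries \<pi>) \<Longrightarrow> j < length (entries \<pi>) \<Longrightarrow>
           (i < j \<longleftrightarrow> fst (f i) < fst (f j)) \<and>
           (entries \<pi> ! i < entries \<pi> ! j \<longleftrightarrow> snd (f i) < snd (f j))"
    and i: "i < length (entries \<pi>)"
  shows "i = card {s \<in> S. fst s < fst (f i)}"
    and "entries \<pi> ! i = card {s \<in> S. snd s < snd (f i)}"
proof -
  let ?n = "length (entries \<pi>)"
  have inj: "inj_on f {..<?n}" and S: "S = f ` {..<?n}"
    using bij by (auto simp: bij_betw_def)
  have "{s \<in> S. fst s < fst (f i)} = f ` {j. j < ?n \<and> j < i}"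
    using ord i unfolding S by blast
  also have "{j. j < ?n \<and> j < i} = {..<i}" using i by auto
  finally have "{s \<in> S. fst s < fst (f i)} = f ` {..<i}" .
  moreover have "inj_on f {..<i}" using inj by (rule inj_on_subset) (use i in auto)
  ultimately show "i = card {s \<in> S. fst s < fst (f i)}" by (simp add: card_image)
  let ?J = "{j. j < ?n \<and> entries \<pi> ! j < entries \<pi> ! i}"
  have "{s \<in> S. snd s < snd (f i)} = f ` ?J"
    using ord i unfolding S by blast
  moreover have "inj_on f ?J" using inj by (rule inj_on_subset) auto
  ultimately have "card {s \<in> S. snd s < snd (f i)} = card ?J" by (simp add: card_image)
  also have "\<dots> = card ((!) (entries \<pi>) ` ?J)"
    using distinct_entries[of \<pi>]
    by (intro card_image[symmetric]) (auto simp: inj_on_def nth_eq_iff_index_eq)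
  also have "(!) (entries \<pi>) ` ?J = {..<entries \<pi> ! i}"
  proof (intro equalityI subsetI)
    fix y assume "y \<in> {..<entries \<pi> ! i}"
    moreover have "entries \<pi> ! i < ?n" using i set_entries[of \<pi>] nth_mem by blast
    ultimately have "y \<in> set (entries \<pi>)" unfolding set_entries by simp
    thus "y \<in> (!) (entries \<pi>) ` ?J"
      using \<open>y \<in> {..<entries \<pi> ! i}\<close> by (auto simp: in_set_conv_nth)
  qed auto
  finally show "entries \<pi> ! i = card {s \<in> S. snd s < snd (f i)}" by simp
qed

lemma represents_order_iso:
  assumes \<pi>: "represents \<pi> S a" and \<sigma>: "represents \<sigma> T b"
    and h: "bij_betw h S T" "h a = b"
    and iso: "\<And>s t. s \<in> S \<Longrightarrow> t \<in> S \<Longrightarrow>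
           (fst s < fst t \<longleftrightarrow> fst (h s) < fst (h t)) \<and> (snd s < snd t \<longleftrightarrow> snd (h s) < snd (h t))"
  shows "\<pi> = \<sigma>"
proof -
  let ?n = "length (entries \<pi>)" and ?m = "length (entries \<sigma>)"
  obtain f where f: "bij_betw f {..<?n} S" "f (origin \<pi>) = a"
      "\<And>i j. i < ?n \<Longrightarrow> j < ?n \<Longrightarrow> (i < j \<longleftrightarrow> fst (f i) < fst (f j)) \<and>
           (entries \<pi> ! i < entries \<pi> ! j \<longleftrightarrow> snd (f i) < snd (f j))"
    using \<pi> unfolding represents_def by blast
  obtain g where g: "bij_betw g {..<?m} T" "g (origin \<sigma>) = b"
      "\<And>i j. i < ?m \<Longrightarrow> j < ?m \<Longrightarrow> (i < j \<longleftrightarrow> fst (g i) < fst (g j)) \<and>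
           (entries \<sigma> ! i < entries \<sigma> ! j \<longleftrightarrow> snd (g i) < snd (g j))"
    using \<sigma> unfolding represents_def by blast
  have n: "?n = ?m"
    using bij_betw_same_card[OF f(1)] bij_betw_same_card[OF g(1)] bij_betw_same_card[OF h(1)] by simp
  have card: "card {t \<in> T. fst t < fst (h s)} = card {t \<in> S. fst t < fst s}"
             "card {t \<in> T. snd t < snd (h s)} = card {t \<in> S. snd t < snd s}" if "s \<in> S" for s
  proof -
    have inj: "inj_on h S" and T: "T = h ` S" using h(1) by (auto simp: bij_betw_def)
    have "{t \<in> T. fst t < fst (h s)} = h ` {t \<in> S. fst t < fst s}"
         "{t \<in> T. snd t < snd (h s)} = h ` {t \<in> S. snd t < snd s}"
      unfolding T using iso that by (blast)+
    moreover have "inj_on h {t \<in> S. fst t < fst s}" "inj_on h {t \<in> S. snd t < snd s}"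
      by (rule inj_on_subset[OF inj]; blast)+
    ultimately show "card {t \<in> T. fst t < fst (h s)} = card {t \<in> S. fst t < fst s}"
         "card {t \<in> T. snd t < snd (h s)} = card {t \<in> S. snd t < snd s}"
      by (simp_all add: card_image)
  qed
  have hf: "h (f i) = g i \<and> entries \<pi> ! i = entries \<sigma> ! i" if i: "i < ?n" for i
  proof -
    have fi: "f i \<in> S" using f(1) i by (auto simp: bij_betw_def)
    hence "h (f i) \<in> T" using h(1) by (auto simp: bij_betw_def)
    then obtain j where j: "j < ?m" "h (f i) = g j" using g(1) by (auto simp: bij_betw_def)
    have "i = j"
      using represents_ranks(1)[OF f(1,3) i] represents_ranks(1)[OF g(1,3) j(1)] card(1)[OF fi] j(2)
      by simp
    moreover have "entries \<pi> ! i = entries \<sigma> ! j"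
      using represents_ranks(2)[OF f(1,3) i] represents_ranks(2)[OF g(1,3) j(1)] card(2)[OF fi] j(2)
      by simp
    ultimately show ?thesis using j by simp
  qed
  have "g (origin \<pi>) = g (origin \<sigma>)"
    using hf[OF origin_less] f(2) g(2) h(2) by metis
  hence "origin \<pi> = origin \<sigma>"
    using g(1) origin_less[of \<pi>] origin_less[of \<sigma>] n by (auto simp: bij_betw_def inj_on_def)
  moreover have "entries \<pi> = entries \<sigma>" using n hf by (intro nth_equalityI) auto
  ultimately show ?thesis by (intro centred_perm_eqI)
qed

lemma rank_bij:
  fixes c :: "'a \<Rightarrow> real"
  assumes "finite S" "inj_on c S"
  shows "bij_betw (\<lambda>s. card {t \<in> S. c t < c s}) S {..<card S}"
    and "\<And>s s'. s \<in> S \<Longrightarrow> s' \<in> S \<Longrightarrow>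
           card {t \<in> S. c t < c s} < card {t \<in> S. c t < c s'} \<longleftrightarrow> c s < c s'"
proof -
  let ?r = "\<lambda>s. card {t \<in> S. c t < c s}"
  have less: "?r s < ?r s'" if "s \<in> S" "c s < c s'" for s s'
    using that assms(1) by (intro psubset_card_mono) auto
  show iff: "?r s < ?r s' \<longleftrightarrow> c s < c s'" if "s \<in> S" "s' \<in> S" for s s'
  proof (cases "c s" "c s'" rule: linorder_cases)
    case less
    thus ?thesis using \<open>s \<in> S\<close> \<open>\<And>s s'. s \<in> S \<Longrightarrow> c s < c s' \<Longrightarrow> ?r s < ?r s'\<close> by simp
  next
    case equal
    thus ?thesis by simp
  next
    case greater
    hence "?r s' < ?r s" using \<open>s' \<in> S\<close> \<open>\<And>s s'. s \<in> S \<Longrightarrow> c s < c s' \<Longrightarrow> ?r s < ?r s'\<close> by simp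
    thus ?thesis using greater by simp
  qed
  have "inj_on ?r S"
  proof (rule inj_onI)
    fix s s' assume s: "s \<in> S" "s' \<in> S" and "?r s = ?r s'"
    hence "\<not> c s < c s'" "\<not> c s' < c s" using iff[OF s] iff[OF s(2,1)] by simp_all
    thus "s = s'" using s assms(2) by (auto simp: inj_on_def)
  qed
  moreover have "?r ` S \<subseteq> {..<card S}"
    using assms(1) by (auto intro!: psubset_card_mono)
  ultimately show "bij_betw ?r S {..<card S}"
    by (simp add: bij_betw_def card_image card_subset_eq)
qed

lemma ex_represents:
  fixes S :: "(real \<times> real) set"
  assumes "finite S" "inj_on fst S" "inj_on snd S" "a \<in> S"
  shows "\<exists>\<pi>. represents \<pi> S a"
proof -
  define x y :: "real \<times> real \<Rightarrow> nat" where "x = (\<lambda>s. card {t \<in> S. fst t < fst s})" and "y = (\<lambda>s. card {t \<in> S. snd t < snd s})"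
  define f where "f = inv_into S x"
  let ?n = "card S"
  have x: "bij_betw x S {..<?n}" "\<And>s t. s \<in> S \<Longrightarrow> t \<in> S \<Longrightarrow> x s < x t \<longleftrightarrow> fst s < fst t"
    and y: "bij_betw y S {..<?n}" "\<And>s t. s \<in> S \<Longrightarrow> t \<in> S \<Longrightarrow> y s < y t \<longleftrightarrow> snd s < snd t"
    using rank_bij[OF assms(1,2)] rank_bij[OF assms(1,3)] by (auto simp: x_def y_def)
  have f: "bij_betw f {..<?n} S" unfolding f_def using x(1) by (rule bij_betw_inv_into)
  have xf: "x (f i) = i" if "i < ?n" for i
    using that x(1) unfolding f_def by (auto simp: bij_betw_def intro!: f_inv_into_f)
  have fS: "f i \<in> S" if "i < ?n" for i using f that by (auto simp: bij_betw_def)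
  have yf: "bij_betw (y \<circ> f) {..<?n} {..<?n}" using f y(1) by (rule bij_betw_trans)
  define xs where "xs = map (y \<circ> f) [0..<?n]"
  have xa: "x a < ?n" using x(1) assms(4) by (auto simp: bij_betw_def)
  have "(xs, x a) \<in> {(xs, c). distinct xs \<and> set xs = {..<length xs} \<and> c < length xs}"
    using yf xa by (auto simp: xs_def distinct_map bij_betw_def atLeast0LessThan)
  hence "Rep_centred_perm (Abs_centred_perm (xs, x a)) = (xs, x a)" by (rule Abs_centred_perm_inverse)
  then obtain \<pi> where "Rep_centred_perm \<pi> = (xs, x a)" ..
  hence \<pi>: "entries \<pi> = xs" "origin \<pi> = x a" by (simp_all add: entries.rep_eq origin.rep_eq)
  have "f (x a) = a"
    using bij_betw_imp_inj_on[OF x(1)] assms(4) unfolding f_def by (rule inv_into_f_f)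
  hence "represents \<pi> S a"
    unfolding represents_def \<pi> using f x(2)[OF fS fS] y(2)[OF fS fS] xf
    by (intro exI[of _ f]) (auto simp: xs_def)
  thus ?thesis by blast
qed


subsection \<open>Pin sequences\<close>

lemma pin_sequence_snoc:
  assumes "w \<noteq> []"
  shows "pin_sequence (w @ [Dir d]) p \<longleftrightarrow>
     pin_sequence w p \<and> (\<forall>i \<le> length w. beyond d (p (Suc (length w))) (p i)) \<and>
     separates (other_coord d (p (Suc (length w)))) (other_coord d (p (length w)))
       ((\<lambda>i. other_coord d (p i)) ` {..<length w})"
proof -
  have *: "2 \<le> k \<and> k \<le> length (w @ [Dir d]) \<longleftrightarrow> 2 \<le> k \<and> k \<le> length w \<or> k = Suc (length w)" for k
    using assms by (cases w) auto
  show ?thesis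
    unfolding pin_sequence_def * using assms
    by (auto simp: nth_append less_Suc_eq_le)
qed

lemma pin_sequence_cong:
  assumes "w \<noteq> []" "\<And>i. i \<le> length w \<Longrightarrow> p i = p' i"
  shows "pin_sequence w p \<longleftrightarrow> pin_sequence w p'"
proof -
  have "pin_sequence w p'" if "pin_sequence w p" and eq: "\<And>i. i \<le> length w \<Longrightarrow> p i = p' i" for p p'
  proof -
    have "1 \<le> length w" using assms(1) by (cases w) auto
    hence "\<exists>q. w ! 0 = Num q \<and> in_quadrant q (p' 0) (p' 1)"
      using that(1) by (simp add: pin_sequence_def eq)
    moreover have "\<exists>d. w ! (k - 1) = Dir d \<and> (\<forall>i < k. beyond d (p' k) (p' i)) \<and>
        separates (other_coord d (p' k)) (other_coord d (p' (k - 1)))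
          ((\<lambda>i. other_coord d (p' i)) ` {..<k - 1})" if k: "2 \<le> k" "k \<le> length w" for k
    proof -
      have "(\<lambda>i. other_coord d (p i)) ` {..<k - 1} = (\<lambda>i. other_coord d (p' i)) ` {..<k - 1}" for d
        using k by (intro image_cong) (auto simp: eq)
      moreover have "p i = p' i" if "i \<le> k" for i using that k by (intro eq) simp
      ultimately show ?thesis
        using \<open>pin_sequence w p\<close> k unfolding pin_sequence_def
        by (metis diff_le_self less_imp_le_nat order_refl)
    qed
    ultimately show ?thesis unfolding pin_sequence_def by blast
  qed
  thus ?thesis using assms(2) by metis
qed

lemma finite_pin_word_induct [consumes 1, case_names single snoc]:
  assumes "finite_pin_word w"
    and "\<And>q. P [Num q]"
    and "\<And>w d. finite_pin_word w \<Longrightarrow> finite_pin_word (w @ [Dir d]) \<Longrightarrow> P w \<Longrightarrow> P (w @ [Dir d])"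
  shows "P w"
  using assms(1)
proof (induction w rule: rev_induct)
  case Nil
  thus ?case by (simp add: finite_pin_word_def)
next
  case (snoc l w)
  show ?case
  proof (cases "w = []")
    case True
    thus ?thesis using snoc.prems assms(2) by (auto simp: finite_pin_word_def)
  next
    case False
    have "\<exists>d. (w @ [l]) ! length w = Dir d"
      using snoc.prems False unfolding finite_pin_word_def
      by (metis One_nat_def Suc_leI length_append_singleton length_greater_0_conv lessI)
    then obtain d where l: "l = Dir d" by auto
    have nth: "(w @ [l]) ! k = w ! k" if "k < length w" for k using that by (simp add: nth_append)
    have "finite_pin_word w"
      unfolding finite_pin_word_def
    proof (intro conjI allI impI)
      show "\<exists>q. w ! 0 = Num q"
        using snoc.prems False nth[of 0] by (auto simp: finite_pin_word_def)
      show "\<exists>d. w ! k = Dir d" if "1 \<le> k \<and> k < length w" for k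
      proof -
        have "\<exists>d. (w @ [l]) ! k = Dir d" using snoc.prems that by (auto simp: finite_pin_word_def)
        thus ?thesis using nth that by simp
      qed
      show "\<not> same_axis a b" if "Suc k < length w \<and> w ! k = Dir a \<and> w ! Suc k = Dir b" for k a b
      proof -
        have "Suc k < length (w @ [l]) \<and> (w @ [l]) ! k = Dir a \<and> (w @ [l]) ! Suc k = Dir b"
          using that nth[of k] nth[of "Suc k"] by auto
        thus ?thesis using snoc.prems unfolding finite_pin_word_def by blast
      qed
    qed (use False in simp)
    thus ?thesis using snoc assms(3) l by blast
  qed
qed

lemma last_pin_extreme:
  assumes "finite_pin_word (w @ [Dir d])" "w \<noteq> []" "pin_sequence w p"
  shows "(\<forall>i < length w. other_coord d (p i) < other_coord d (p (length w))) \<or>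
         (\<forall>i < length w. other_coord d (p i) > other_coord d (p (length w)))"
proof (cases "length w = 1")
  case True
  obtain q where "in_quadrant q (p 0) (p 1)" using assms(3) by (auto simp: pin_sequence_def)
  thus ?thesis using True by (cases q; cases d) auto
next
  case False
  hence len: "2 \<le> length w" using assms(2) by (cases w) (auto simp: Suc_le_eq)
  then obtain e where e: "w ! (length w - 1) = Dir e" "\<forall>i < length w. beyond e (p (length w)) (p i)"
    using assms(3) unfolding pin_sequence_def by blast
  have "\<not> same_axis e d"
  proof -
    have "Suc (length w - 1) < length (w @ [Dir d])" "(w @ [Dir d]) ! (length w - 1) = Dir e"
         "(w @ [Dir d]) ! Suc (length w - 1) = Dir d"
      using len e(1) by (auto simp: nth_append)
    thus ?thesis using assms(1) unfolding finite_pin_word_def by blast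
  qed
  thus ?thesis using e(2) by (cases e; cases d) (auto simp: same_axis_def)
qed

lemma ex_separating:
  fixes y :: real
  assumes "finite T" "(\<forall>t \<in> T. t < y) \<or> (\<forall>t \<in> T. y < t)"
  shows "\<exists>x. separates x y T"
  using assms(2)
proof
  assume T: "\<forall>t \<in> T. t < y"
  have "Max (insert (y - 1) T) < y" using T assms(1) by simp
  then obtain x where "Max (insert (y - 1) T) < x" "x < y" using dense by blast
  thus ?thesis using assms(1) by (auto simp: separates_def)
next
  assume T: "\<forall>t \<in> T. y < t"
  have "y < Min (insert (y + 1) T)" using T assms(1) by simp
  then obtain x where "x < Min (insert (y + 1) T)" "y < x" using dense by blast
  thus ?thesis using assms(1) by (auto simp: separates_def)
qed

lemma ex_beyond:
  assumes "finite S"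
  shows "\<exists>z. other_coord d z = x \<and> (\<forall>s \<in> S. beyond d z s)"
proof -
  have hi: "\<exists>M. \<forall>s \<in> S. f s < M" for f :: "real \<times> real \<Rightarrow> real"
  proof (intro exI ballI)
    fix s assume "s \<in> S"
    hence "f s \<le> Max (f ` S)" using assms by simp
    thus "f s < Max (f ` S) + 1" by simp
  qed
  obtain a where a: "\<forall>s \<in> S. fst s < a" using hi by blast
  obtain b where b: "\<forall>s \<in> S. snd s < b" using hi by blast
  obtain a' where a': "\<forall>s \<in> S. - fst s < a'" using hi[of "\<lambda>s. - fst s"] by blast
  obtain b' where b': "\<forall>s \<in> S. - snd s < b'" using hi[of "\<lambda>s. - snd s"] by blast
  show ?thesis
  proof (cases d)
    case Up thus ?thesis using b by (intro exI[of _ "(x, b)"]) auto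
  next
    case Down thus ?thesis using b' by (intro exI[of _ "(x, - b')"]) force
  next
    case Left thus ?thesis using a' by (intro exI[of _ "(- a', x)"]) force
  next
    case Right thus ?thesis using a by (intro exI[of _ "(a, x)"]) auto
  qed
qed

theorem ex_pin_sequence:
  assumes "finite_pin_word w"
  shows "\<exists>p. pin_sequence w p"
  using assms
proof (induction rule: finite_pin_word_induct)
  case (single q)
  have "\<exists>z. in_quadrant q (0, 0) z"
  proof (cases q)
    case Q1 thus ?thesis by (intro exI[of _ "(1, 1)"]) simp
  next
    case Q2 thus ?thesis by (intro exI[of _ "(-1, 1)"]) simp
  next
    case Q3 thus ?thesis by (intro exI[of _ "(-1, -1)"]) simp
  next
    case Q4 thus ?thesis by (intro exI[of _ "(1, -1)"]) simp
  qed
  then obtain z where "in_quadrant q (0, 0) z" ..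
  hence "pin_sequence [Num q] (\<lambda>i. if i = 0 then (0, 0) else z)" by (simp add: pin_sequence_def)
  thus ?case by blast
next
  case (snoc w d)
  then obtain p where p: "pin_sequence w p" by blast
  have ne: "w \<noteq> []" using snoc by (simp add: finite_pin_word_def)
  let ?n = "length w" and ?T = "(\<lambda>i. other_coord d (p i)) ` {..<length w}"
  have "\<exists>x. separates x (other_coord d (p ?n)) ?T"
    using last_pin_extreme[OF snoc(2) ne p] by (intro ex_separating) auto
  then obtain x where x: "separates x (other_coord d (p ?n)) ?T" ..
  obtain z where z: "other_coord d z = x" "\<forall>s \<in> p ` {..?n}. beyond d z s"
    using ex_beyond[of "p ` {..?n}" d x] by auto
  let ?p = "p(Suc ?n := z)"
  have "pin_sequence w ?p" using p pin_sequence_cong[OF ne, of p ?p] by simp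
  moreover have "(\<lambda>i. other_coord d (?p i)) ` {..<length w} = ?T" by (intro image_cong) auto
  ultimately have "pin_sequence (w @ [Dir d]) ?p"
    using x z by (simp add: pin_sequence_snoc[OF ne])
  thus ?case by blast
qed

lemma pin_sequences_distinct_order_iso:
  assumes "finite_pin_word w" "pin_sequence w p" "pin_sequence w p'"
    and "i \<le> length w" "j \<le> length w"
  shows "(i \<noteq> j \<longrightarrow> fst (p i) \<noteq> fst (p j) \<and> snd (p i) \<noteq> snd (p j)) \<and>
         (fst (p i) < fst (p j) \<longleftrightarrow> fst (p' i) < fst (p' j)) \<and>
         (snd (p i) < snd (p j) \<longleftrightarrow> snd (p' i) < snd (p' j))"
  using assms
proof (induction arbitrary: i j rule: finite_pin_word_induct)
  case (single q)
  hence "in_quadrant q (p 0) (p 1)" "in_quadrant q (p' 0) (p' 1)" by (auto simp: pin_sequence_def)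
  moreover have "i \<in> {0, 1}" "j \<in> {0, 1}" using single by auto
  ultimately show ?case by (cases q) auto
next
  case (snoc w d)
  let ?n = "length w"
  have ne: "w \<noteq> []" using snoc by (simp add: finite_pin_word_def)
  have old: "pin_sequence w p" "pin_sequence w p'"
    and bey: "\<forall>i \<le> ?n. beyond d (p (Suc ?n)) (p i)" "\<forall>i \<le> ?n. beyond d (p' (Suc ?n)) (p' i)"
    and sep: "separates (other_coord d (p (Suc ?n))) (other_coord d (p ?n))
                ((\<lambda>i. other_coord d (p i)) ` {..<?n})"
             "separates (other_coord d (p' (Suc ?n))) (other_coord d (p' ?n))
                ((\<lambda>i. other_coord d (p' i)) ` {..<?n})"
    using snoc.prems by (simp_all add: pin_sequence_snoc[OF ne])
  note IH = snoc.IH[OF old]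
  have new: "(fst (p k) \<noteq> fst (p (Suc ?n)) \<and> snd (p k) \<noteq> snd (p (Suc ?n))) \<and>
         (fst (p k) < fst (p (Suc ?n)) \<longleftrightarrow> fst (p' k) < fst (p' (Suc ?n))) \<and>
         (snd (p k) < snd (p (Suc ?n)) \<longleftrightarrow> snd (p' k) < snd (p' (Suc ?n))) \<and>
         (fst (p (Suc ?n)) < fst (p k) \<longleftrightarrow> fst (p' (Suc ?n)) < fst (p' k)) \<and>
         (snd (p (Suc ?n)) < snd (p k) \<longleftrightarrow> snd (p' (Suc ?n)) < snd (p' k))" if k: "k \<le> ?n" for k
  proof -
    let ?x = "\<lambda>i. other_coord d (p i)" and ?x' = "\<lambda>i. other_coord d (p' i)"
    have eq: "?x 0 < ?x ?n \<longleftrightarrow> ?x' 0 < ?x' ?n"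
      using IH[of 0 ?n] by (cases d) auto
    have 0: "0 < ?n" using ne by simp
    have s: "(\<forall>i < ?n. ?x i < ?x (Suc ?n)) \<and> ?x (Suc ?n) < ?x ?n \<or>
             (\<forall>i < ?n. ?x (Suc ?n) < ?x i) \<and> ?x ?n < ?x (Suc ?n)"
      and s': "(\<forall>i < ?n. ?x' i < ?x' (Suc ?n)) \<and> ?x' (Suc ?n) < ?x' ?n \<or>
             (\<forall>i < ?n. ?x' (Suc ?n) < ?x' i) \<and> ?x' ?n < ?x' (Suc ?n)"
      using sep by (auto simp: separates_def)
    have "?x k \<noteq> ?x (Suc ?n) \<and> (?x k < ?x (Suc ?n) \<longleftrightarrow> ?x' k < ?x' (Suc ?n)) \<and>
          (?x (Suc ?n) < ?x k \<longleftrightarrow> ?x' (Suc ?n) < ?x' k)"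
    proof (cases "?x 0 < ?x ?n")
      case True
      have a: "(\<forall>i < ?n. ?x i < ?x (Suc ?n)) \<and> ?x (Suc ?n) < ?x ?n"
        using s 0 True by (smt (verit))
      have a': "(\<forall>i < ?n. ?x' i < ?x' (Suc ?n)) \<and> ?x' (Suc ?n) < ?x' ?n"
        using s' 0 True eq by (smt (verit))
      show ?thesis
      proof (cases "k = ?n")
        case False
        hence "?x k < ?x (Suc ?n)" "?x' k < ?x' (Suc ?n)" using a a' k by auto
        thus ?thesis by simp
      qed (use a a' in simp)
    next
      case False
      have a: "(\<forall>i < ?n. ?x (Suc ?n) < ?x i) \<and> ?x ?n < ?x (Suc ?n)"
        using s 0 False by (smt (verit))
      have a': "(\<forall>i < ?n. ?x' (Suc ?n) < ?x' i) \<and> ?x' ?n < ?x' (Suc ?n)"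
        using s' 0 False eq by (smt (verit))
      show ?thesis
      proof (cases "k = ?n")
        case False
        hence "?x (Suc ?n) < ?x k" "?x' (Suc ?n) < ?x' k" using a a' k by auto
        thus ?thesis by simp
      qed (use a a' in simp)
    qed
    moreover have "beyond d (p (Suc ?n)) (p k)" "beyond d (p' (Suc ?n)) (p' k)" using bey k by auto
    ultimately show ?thesis by (cases d) auto
  qed
  consider "i \<le> ?n" "j \<le> ?n" | "i \<le> ?n" "j = Suc ?n" | "i = Suc ?n" "j \<le> ?n"
    | "i = Suc ?n" "j = Suc ?n" using snoc.prems by force
  thus ?case
  proof cases
    case 1 thus ?thesis using IH by blast
  next
    case 2 thus ?thesis using new[of i] by auto
  next
    case 3 thus ?thesis using new[of j] by metis
  next
    case 4 thus ?thesis by simp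
  qed
qed

lemma pin_sequence_inj:
  assumes "finite_pin_word w" "pin_sequence w p"
  shows "inj_on p {..length w}" "inj_on fst (p ` {..length w})" "inj_on snd (p ` {..length w})"
proof -
  note d = pin_sequences_distinct_order_iso[OF assms assms(2), THEN conjunct1, rule_format]
  have "i = j" if "i \<le> length w" "j \<le> length w" "fst (p i) = fst (p j) \<or> snd (p i) = snd (p j)" for i j
    using d[OF that(1,2)] that(3) by blast
  thus "inj_on p {..length w}" "inj_on fst (p ` {..length w})" "inj_on snd (p ` {..length w})"
    by (auto simp: inj_on_def)
qed

theorem ex1_pin_perm:
  assumes "finite_pin_word w"
  shows "\<exists>!\<pi>. \<exists>p. pin_sequence w p \<and> represents \<pi> (p ` {..length w}) (p 0)"
proof (rule ex_ex1I)
  obtain p where p: "pin_sequence w p" using ex_pin_sequence[OF assms] ..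
  hence "\<exists>\<pi>. represents \<pi> (p ` {..length w}) (p 0)"
    using pin_sequence_inj[OF assms] by (intro ex_represents) auto
  thus "\<exists>\<pi> p. pin_sequence w p \<and> represents \<pi> (p ` {..length w}) (p 0)" using p by blast
next
  fix \<pi> \<sigma>
  assume "\<exists>p. pin_sequence w p \<and> represents \<pi> (p ` {..length w}) (p 0)"
     and "\<exists>p. pin_sequence w p \<and> represents \<sigma> (p ` {..length w}) (p 0)"
  then obtain p p' where p: "pin_sequence w p" "represents \<pi> (p ` {..length w}) (p 0)"
    and p': "pin_sequence w p'" "represents \<sigma> (p' ` {..length w}) (p' 0)" by blast
  define h where "h = p' \<circ> inv_into {..length w} p"
  have h: "h (p i) = p' i" if "i \<le> length w" for i
    using that pin_sequence_inj(1)[OF assms p(1)] by (simp add: h_def)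
  show "\<pi> = \<sigma>"
  proof (rule represents_order_iso[OF p(2) p'(2)])
    show "bij_betw h (p ` {..length w}) (p' ` {..length w})"
      unfolding h_def
      using pin_sequence_inj(1)[OF assms p(1)] pin_sequence_inj(1)[OF assms p'(1)]
      by (intro bij_betw_trans[OF bij_betw_inv_into]) (auto simp: bij_betw_def)
    show "h (p 0) = p' 0" by (simp add: h)
  next
    fix s t assume "s \<in> p ` {..length w}" "t \<in> p ` {..length w}"
    then obtain i j where "i \<le> length w" "j \<le> length w" "s = p i" "t = p j" by blast
    thus "(fst s < fst t \<longleftrightarrow> fst (h s) < fst (h t)) \<and> (snd s < snd t \<longleftrightarrow> snd (h s) < snd (h t))"
      using pin_sequences_distinct_order_iso[OF assms p(1) p'(1)] by (simp add: h)
  qed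
qed

lemma cp_length_pin_perm:
  assumes "finite_pin_word w"
  shows "cp_length (pin_perm w) = length w"
proof -
  have "\<exists>p. pin_sequence w p \<and> represents (pin_perm w) (p ` {..length w}) (p 0)"
    unfolding pin_perm_def by (rule theI'[OF ex1_pin_perm[OF assms]])
  then obtain p f where p: "pin_sequence w p"
    and "bij_betw f {..<length (entries (pin_perm w))} (p ` {..length w})"
    unfolding represents_def by blast
  hence "length (entries (pin_perm w)) = card (p ` {..length w})"
    using bij_betw_same_card by fastforce
  also have "\<dots> = Suc (length w)"
    using pin_sequence_inj(1)[OF assms p] by (simp add: card_image)
  finally show ?thesis by (simp add: cp_length_def)
qed

lemma in_quadrant_unique: "in_quadrant q a b \<Longrightarrow> in_quadrant q' a b \<Longrightarrow> q = q'"
  by (cases q; cases q') auto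

theorem ex1_pin_quadrant:
  assumes "infinite_pin_word w" "1 \<le> i"
  shows "\<exists>!q. \<exists>p. pin_sequence (word_prefix w i) p \<and> in_quadrant q (p 0) (p i)"
proof -
  have w: "finite_pin_word (word_prefix w i)" using assms by (simp add: infinite_pin_word_def)
  have len: "length (word_prefix w i) = i" by (simp add: word_prefix_def)
  note iso = pin_sequences_distinct_order_iso[OF w, unfolded len]
  obtain p where p: "pin_sequence (word_prefix w i) p" using ex_pin_sequence[OF w] ..
  have "fst (p 0) \<noteq> fst (p i)" "snd (p 0) \<noteq> snd (p i)" using iso[OF p p, of 0 i] assms(2) by auto
  hence "in_quadrant Q1 (p 0) (p i) \<or> in_quadrant Q2 (p 0) (p i) \<or>
         in_quadrant Q3 (p 0) (p i) \<or> in_quadrant Q4 (p 0) (p i)" by auto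
  then obtain q where q: "in_quadrant q (p 0) (p i)" by blast
  show ?thesis
  proof (rule ex1I[of _ q])
    fix q' assume "\<exists>p. pin_sequence (word_prefix w i) p \<and> in_quadrant q' (p 0) (p i)"
    then obtain p' where p': "pin_sequence (word_prefix w i) p'" "in_quadrant q' (p' 0) (p' i)" by blast
    have "in_quadrant q' (p 0) (p i)"
      using p'(2) iso[OF p p'(1), of 0 i] iso[OF p p'(1), of i 0] by (cases q') auto
    thus "q' = q" using q by (rule in_quadrant_unique)
  qed (use p q in blast)
qed

end

theory Submission
  imports Defs
begin

text \<open>
  Let \<open>p\<close> be a pin sequence of \<open>w\<close>. For \<open>k \<ge> 2\<close> all of \<open>p\<^sub>0, \<dots>, p\<^sub>k\<^sub>-\<^sub>2\<close> lie in the same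
  quadrant as seen from \<open>p\<^sub>k\<close>. Hence for \<open>i \<ge> n + 2\<close> none of the pins \<open>p\<^sub>i, \<dots>, p\<^sub>j\<close> cuts the block
  \<open>p\<^sub>0, \<dots>, p\<^sub>n\<close>, so that these pins together with the block form the box sum of the centred
  permutations of \<open>w\<^sub>1\<^sub>,\<^sub>n\<close> and \<open>w\<^sub>i\<^sub>,\<^sub>j\<close>. By recurrence \<open>w\<^sub>i\<^sub>,\<^sub>j\<close> can be chosen equal to any given prefix
  of \<open>w\<close> with \<open>i\<close> arbitrarily large.
\<close>

section \<open>Embedding centred permutations into planar point sets\<close>

text \<open>This weakens \<open>represents\<close> from a bijection onto \<open>S\<close> to a map
  into \<open>S\<close>; the order conditions make the map injective. Containment can then be
  checked on the points of a pin sequence instead of on one-line notation.\<close>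

definition embeds :: "centred_perm \<Rightarrow> (real \<times> real) set \<Rightarrow> real \<times> real \<Rightarrow> bool" where
  "embeds \<pi> S c \<longleftrightarrow>
     (\<exists>f. f ` {..<length (entries \<pi>)} \<subseteq> S \<and>
          (\<forall>i < length (entries \<pi>). \<forall>j < length (entries \<pi>).
             (i < j \<longleftrightarrow> fst (f i) < fst (f j)) \<and>
             (entries \<pi> ! i < entries \<pi> ! j \<longleftrightarrow> snd (f i) < snd (f j))) \<and>
          f (origin \<pi>) = c)"

lemma embeds_mono:
  assumes "embeds \<pi> S c" "S \<subseteq> T"
  shows "embeds \<pi> T c"
proof -
  obtain f where f: "f ` {..<length (entries \<pi>)} \<subseteq> S"
      "\<forall>i < length (entries \<pi>). \<forall>j < length (entries \<pi>).
         (i < j \<longleftrightarrow> fst (f i) < fst (f j)) \<and>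
         (entries \<pi> ! i < entries \<pi> ! j \<longleftrightarrow> snd (f i) < snd (f j))"
      "f (origin \<pi>) = c"
    using assms(1) unfolding embeds_def by blast
  have "f ` {..<length (entries \<pi>)} \<subseteq> T" using f(1) assms(2) by (rule order_trans)
  thus ?thesis unfolding embeds_def using f(2,3) by (intro exI[of _ f] conjI)
qed

text \<open>A containment map composed with the representing bijection \<open>g\<close> is an
  embedding into \<open>S\<close>; composing an embedding with the inverse of \<open>g\<close> leads
  back. The main proof uses both directions: to realise the two summands as points and to read off
  their box sum.\<close>

lemma contained_iff_embeds:
  assumes "represents \<sigma> S c"
  shows "\<pi> \<preceq> \<sigma> \<longleftrightarrow> embeds \<pi> S c"
proof -
  let ?n = "length (entries \<pi>)" and ?m = "length (entries \<sigma>)"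
  obtain g where bij: "bij_betw g {..<?m} S"
    and g: "\<And>i j. i < ?m \<Longrightarrow> j < ?m \<Longrightarrow> (i < j \<longleftrightarrow> fst (g i) < fst (g j)) \<and>
           (entries \<sigma> ! i < entries \<sigma> ! j \<longleftrightarrow> snd (g i) < snd (g j))"
    and c: "g (origin \<sigma>) = c"
    using assms unfolding represents_def by blast
  show ?thesis
  proof
    assume "\<pi> \<preceq> \<sigma>"
    then obtain f where f: "strict_mono_on {..<?n} f" "f ` {..<?n} \<subseteq> {..<?m}"
        "\<forall>i<?n. \<forall>j<?n. entries \<pi> ! i < entries \<pi> ! j \<longleftrightarrow> entries \<sigma> ! f i < entries \<sigma> ! f j"
        "f (origin \<pi>) = origin \<sigma>"
      unfolding contained_def by blast
    have m: "f i < ?m" if "i < ?n" for i using f(2) that by blast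
    have "(g \<circ> f) ` {..<?n} \<subseteq> S" using m bij by (auto simp: bij_betw_def)
    moreover have "(i < j \<longleftrightarrow> fst (g (f i)) < fst (g (f j))) \<and>
        (entries \<pi> ! i < entries \<pi> ! j \<longleftrightarrow> snd (g (f i)) < snd (g (f j)))"
      if "i < ?n" "j < ?n" for i j
      using g[OF m m, OF that] f(3) that strict_mono_on_less[OF f(1), of i j] by auto
    ultimately show "embeds \<pi> S c"
      unfolding embeds_def using c f(4) by (intro exI[of _ "g \<circ> f"]) auto
  next
    assume "embeds \<pi> S c"
    then obtain f where f: "f ` {..<?n} \<subseteq> S" "f (origin \<pi>) = c"
        "\<And>i j. i < ?n \<Longrightarrow> j < ?n \<Longrightarrow> (i < j \<longleftrightarrow> fst (f i) < fst (f j)) \<and>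
           (entries \<pi> ! i < entries \<pi> ! j \<longleftrightarrow> snd (f i) < snd (f j))"
      unfolding embeds_def by blast
    define h where "h = inv_into {..<?m} g \<circ> f"
    have h: "h i < ?m \<and> g (h i) = f i" if "i < ?n" for i
    proof -
      have "f i \<in> g ` {..<?m}" using f(1) bij that by (auto simp: bij_betw_def)
      thus ?thesis
        using inv_into_into[of "f i" g "{..<?m}"] by (simp add: h_def f_inv_into_f)
    qed
    have iso: "(i < j \<longleftrightarrow> h i < h j) \<and>
        (entries \<pi> ! i < entries \<pi> ! j \<longleftrightarrow> entries \<sigma> ! h i < entries \<sigma> ! h j)"
      if "i < ?n" "j < ?n" for i j
      using h[OF that(1)] h[OF that(2)] g[of "h i" "h j"] f(3)[OF that] by simp
    have "h (origin \<pi>) = origin \<sigma>"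
      using bij_betw_imp_inj_on[OF bij] origin_less[of \<sigma>] by (simp add: h_def f(2) flip: c)
    thus "\<pi> \<preceq> \<sigma>"
      unfolding contained_def using h iso
      by (intro exI[of _ h]) (auto simp: strict_mono_on_def)
  qed
qed

lemma contained_trans:
  assumes "\<pi> \<preceq> \<rho>" "\<rho> \<preceq> \<sigma>"
  shows "\<pi> \<preceq> \<sigma>"
proof -
  let ?n = "\<lambda>\<pi>. length (entries \<pi>)"
  obtain f where f: "strict_mono_on {..<?n \<pi>} f" "f ` {..<?n \<pi>} \<subseteq> {..<?n \<rho>}"
      "\<forall>i<?n \<pi>. \<forall>j<?n \<pi>. entries \<pi> ! i < entries \<pi> ! j \<longleftrightarrow> entries \<rho> ! f i < entries \<rho> ! f j"
      "f (origin \<pi>) = origin \<rho>"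
    using assms(1) unfolding contained_def by blast
  obtain g where g: "strict_mono_on {..<?n \<rho>} g" "g ` {..<?n \<rho>} \<subseteq> {..<?n \<sigma>}"
      "\<forall>i<?n \<rho>. \<forall>j<?n \<rho>. entries \<rho> ! i < entries \<rho> ! j \<longleftrightarrow> entries \<sigma> ! g i < entries \<sigma> ! g j"
      "g (origin \<rho>) = origin \<sigma>"
    using assms(2) unfolding contained_def by blast
  have m: "f i < ?n \<rho>" if "i < ?n \<pi>" for i using f(2) that by blast
  have "strict_mono_on {..<?n \<pi>} (g \<circ> f)"
    using f(1) g(1) m by (simp add: strict_mono_on_def)
  thus ?thesis
    unfolding contained_def using f g m
    by (intro exI[of _ "g \<circ> f"]) (auto simp: image_subset_iff)
qed

section \<open>Box sums of embedded permutations\<close>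

lemma entries_box_sum:
  "entries (\<pi> \<boxplus> \<sigma>) =
     (let b = origin \<sigma>; v = entries \<sigma> ! b;
          g = (\<lambda>y. if v < y then y + (length (entries \<pi>) - 1) else y)
      in map g (take b (entries \<sigma>)) @ map (\<lambda>x. x + v) (entries \<pi>) @
         map g (drop (Suc b) (entries \<sigma>)))"
  by transfer (auto simp: Let_def split_beta)

lemma origin_box_sum: "origin (\<pi> \<boxplus> \<sigma>) = origin \<sigma> + origin \<pi>"
  by transfer (auto simp: Let_def split_beta)

text \<open>Assumption \<open>side\<close> expresses that no point of \<open>T\<close> other than
  \<open>c\<close> cuts \<open>S\<close>: each sees all of \<open>S\<close> on the same sides as
  \<open>c\<close>. So \<open>S\<close> can stand in for the inflated origin, and the two embeddings
  glue together.\<close>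

lemma embeds_box_sum:
  assumes \<pi>: "embeds \<pi> S c" and \<sigma>: "embeds \<sigma> T c"
    and side: "\<And>s t. s \<in> S \<Longrightarrow> t \<in> T \<Longrightarrow> t \<noteq> c \<Longrightarrow>
       (fst s < fst t \<longleftrightarrow> fst c < fst t) \<and> (fst t < fst s \<longleftrightarrow> fst t < fst c) \<and>
       (snd s < snd t \<longleftrightarrow> snd c < snd t) \<and> (snd t < snd s \<longleftrightarrow> snd t < snd c)"
  shows "embeds (\<pi> \<boxplus> \<sigma>) (S \<union> T) c"
proof -
  define xs a ys b where "xs = entries \<pi>" and "a = origin \<pi>"
    and "ys = entries \<sigma>" and "b = origin \<sigma>"
  define m v zs where "m = length xs" and "v = ys ! b" and "zs = entries (\<pi> \<boxplus> \<sigma>)"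
  \<comment> \<open>One shift serves twice: \<open>up v\<close> relabels the values of the outer
    entries, \<open>up b\<close> their positions.\<close>
  define up :: "nat \<Rightarrow> nat \<Rightarrow> nat" where "up = (\<lambda>z y. if z < y then y + (m - 1) else y)"
  have a: "a < m" and b: "b < length ys"
    using origin_less[of \<pi>] origin_less[of \<sigma>] by (simp_all add: a_def m_def xs_def b_def ys_def)
  have zs: "zs = map (up v) (take b ys) @ map (\<lambda>x. x + v) xs @ map (up v) (drop (Suc b) ys)"
    by (simp add: zs_def entries_box_sum Let_def up_def v_def m_def xs_def ys_def b_def)
  have len: "length zs = length ys + (m - 1)" using a b by (simp add: zs flip: m_def)
  obtain f where f: "f ` {..<m} \<subseteq> S" "f a = c"
      "\<And>i j. i < m \<Longrightarrow> j < m \<Longrightarrow> (i < j \<longleftrightarrow> fst (f i) < fst (f j)) \<and>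
         (xs ! i < xs ! j \<longleftrightarrow> snd (f i) < snd (f j))"
    using \<pi> unfolding embeds_def xs_def a_def m_def by blast
  obtain g where g: "g ` {..<length ys} \<subseteq> T" "g b = c"
      "\<And>i j. i < length ys \<Longrightarrow> j < length ys \<Longrightarrow> (i < j \<longleftrightarrow> fst (g i) < fst (g j)) \<and>
         (ys ! i < ys ! j \<longleftrightarrow> snd (g i) < snd (g j))"
    using \<sigma> unfolding embeds_def ys_def b_def by blast
  \<comment> \<open>Positions \<open>b\<close> to \<open>b + m - 1\<close> form the block and follow
    \<open>f\<close>; later positions are shifted back by \<open>m - 1\<close> before applying
    \<open>g\<close>. The index \<open>b\<close> of \<open>g\<close> is skipped, as its image
    \<open>c\<close> is already hit by \<open>f a\<close>.\<close>
  define h where "h = (\<lambda>k. if k < b then g k else if k < b + m then f (k - b) else g (k - (m - 1)))"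
  have cases: "(\<exists>x < m. k = b + x \<and> zs ! k = xs ! x + v \<and> h k = f x) \<or>
      (\<exists>y < length ys. y \<noteq> b \<and> k = up b y \<and> zs ! k = up v (ys ! y) \<and> h k = g y)"
    if k: "k < length zs" for k
  proof -
    consider "k < b" | "b \<le> k" "k < b + m" | "b + m \<le> k" by linarith
    thus ?thesis
    proof cases
      case 1
      thus ?thesis using b by (intro disjI2 exI[of _ k]) (auto simp: zs up_def h_def nth_append)
    next
      case 2
      thus ?thesis using b by (intro disjI1 exI[of _ "k - b"])
        (auto simp: zs h_def nth_append m_def)
    next
      case 3
      moreover from 3 have "Suc (k - m) = Suc k - m" by simp
      ultimately show ?thesis using a b k
        by (intro disjI2 exI[of _ "k - (m - 1)"])
           (auto simp: len, auto simp: zs up_def h_def nth_append simp flip: m_def)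
    qed
  qed
  \<comment> \<open>Block values thus stay below \<open>v + m\<close>, the least value a raised
    outer entry can take.\<close>
  have xs_less: "xs ! x < m" if "x < m" for x
    using that set_entries[of \<pi>] nth_mem unfolding xs_def m_def by blast
  have v_neq: "ys ! y \<noteq> v" if "y < length ys" "y \<noteq> b" for y
    using that b distinct_entries[of \<sigma>] by (simp add: v_def ys_def nth_eq_iff_index_eq)
  \<comment> \<open>Since \<open>g b = c\<close>, the position of \<open>g y\<close> relative to
    \<open>c\<close> is that of \<open>y\<close> relative to \<open>b\<close> and of
    \<open>ys ! y\<close> relative to \<open>v\<close>; \<open>side\<close> transfers this from
    \<open>c\<close> to every \<open>f x\<close>.\<close>
  have inner_outer: "(fst (f x) < fst (g y) \<longleftrightarrow> b < y) \<and> (fst (g y) < fst (f x) \<longleftrightarrow> y < b) \<and>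
      (snd (f x) < snd (g y) \<longleftrightarrow> v < ys ! y) \<and> (snd (g y) < snd (f x) \<longleftrightarrow> ys ! y < v)"
    if "x < m" "y < length ys" "y \<noteq> b" for x y
  proof -
    note bg = g(3)[OF b that(2), unfolded g(2)] g(3)[OF that(2) b, unfolded g(2)]
    have "g y \<noteq> c"
    proof
      assume "g y = c"
      hence "\<not> b < y" "\<not> y < b" using bg by simp_all
      thus False using that(3) by simp
    qed
    moreover have "f x \<in> S" "g y \<in> T" using f(1) g(1) that by auto
    ultimately show ?thesis
      using side[of "f x" "g y"] bg unfolding v_def by blast
  qed
  have "(i < j \<longleftrightarrow> fst (h i) < fst (h j)) \<and> (zs ! i < zs ! j \<longleftrightarrow> snd (h i) < snd (h j))"
    if "i < length zs" "j < length zs" for i j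
    using cases[OF that(1)] cases[OF that(2)]
  proof (elim disjE exE conjE)
    fix x x' assume "x < m" "i = b + x" "zs ! i = xs ! x + v" "h i = f x"
      "x' < m" "j = b + x'" "zs ! j = xs ! x' + v" "h j = f x'"
    thus ?thesis using f(3)[of x x'] by simp
  next
    fix x y assume *: "x < m" "i = b + x" "zs ! i = xs ! x + v" "h i = f x"
      "y < length ys" "y \<noteq> b" "j = up b y" "zs ! j = up v (ys ! y)" "h j = g y"
    thus ?thesis using inner_outer[OF *(1,5,6)] xs_less[OF *(1)] v_neq[OF *(5,6)]
      by (auto simp: up_def)
  next
    fix x y assume *: "x < m" "j = b + x" "zs ! j = xs ! x + v" "h j = f x"
      "y < length ys" "y \<noteq> b" "i = up b y" "zs ! i = up v (ys ! y)" "h i = g y"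
    thus ?thesis using inner_outer[OF *(1,5,6)] xs_less[OF *(1)] v_neq[OF *(5,6)]
      by (auto simp: up_def)
  next
    fix y y' assume "y < length ys" "i = up b y" "zs ! i = up v (ys ! y)" "h i = g y"
      "y' < length ys" "j = up b y'" "zs ! j = up v (ys ! y')" "h j = g y'"
    thus ?thesis using g(3)[of y y'] by (auto simp: up_def)
  qed
  moreover have "h k \<in> S \<union> T" if "k < length zs" for k
    using cases[OF that] f(1) g(1) by auto
  moreover have "h (origin (\<pi> \<boxplus> \<sigma>)) = c"
    using a f(2) by (simp add: origin_box_sum h_def flip: a_def b_def)
  ultimately show ?thesis
    unfolding embeds_def zs_def[symmetric] by (intro exI[of _ h] conjI image_subsetI) auto
qed

section \<open>Pin sequences and their factors\<close>

text \<open>The order type does not depend on the chosen pin sequence, by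
  \<open>ex1_pin_perm\<close>. Hence pins taken from a longer sequence may serve to realise
  \<open>pin_perm w\<close>.\<close>

lemma represents_pin_perm:
  assumes "finite_pin_word w" "pin_sequence w p"
  shows "represents (pin_perm w) (p ` {..length w}) (p 0)"
proof -
  obtain \<pi> where \<pi>: "represents \<pi> (p ` {..length w}) (p 0)"
    using ex_represents[OF _ pin_sequence_inj(2,3)[OF assms], of "p 0"] by auto
  hence "pin_perm w = \<pi>"
    unfolding pin_perm_def using ex1_pin_perm[OF assms(1)] assms(2) by (intro the1_equality) auto
  thus ?thesis using \<pi> by simp
qed

lemma length_word_prefix [simp]: "length (word_prefix w n) = n"
  by (simp add: word_prefix_def)

lemma nth_word_prefix [simp]: "k < n \<Longrightarrow> word_prefix w n ! k = w k"
  by (simp add: word_prefix_def)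

lemma length_pin_factor: "1 \<le> i \<Longrightarrow> i \<le> j \<Longrightarrow> length (pin_factor w i j) = Suc (j - i)"
  by (auto simp: pin_factor_def)

lemma pin_sequence_word_prefix:
  assumes "pin_sequence (word_prefix w n) p" "1 \<le> k" "k \<le> n"
  shows "pin_sequence (word_prefix w k) p"
proof -
  have "\<exists>d. word_prefix w k ! (l - 1) = Dir d \<and> (\<forall>i < l. beyond d (p l) (p i)) \<and>
      separates (other_coord d (p l)) (other_coord d (p (l - 1)))
        ((\<lambda>i. other_coord d (p i)) ` {..<l - 1})"
    if l: "2 \<le> l" "l \<le> k" for l
  proof -
    have "word_prefix w k ! (l - 1) = word_prefix w n ! (l - 1)" using l assms(3) by simp
    moreover have "2 \<le> l \<and> l \<le> length (word_prefix w n)" using l assms(3) by simp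
    ultimately show ?thesis using assms(1) unfolding pin_sequence_def by presburger
  qed
  moreover have "word_prefix w k ! 0 = word_prefix w n ! 0" using assms(2,3) by simp
  moreover have "\<exists>q. word_prefix w n ! 0 = Num q \<and> in_quadrant q (p 0) (p 1)"
    using assms(1) unfolding pin_sequence_def by blast
  ultimately show ?thesis unfolding pin_sequence_def length_word_prefix by metis
qed

text \<open>Along its direction the pin is beyond all earlier points; in the other coordinate it
  separates its predecessor from the rest. Only \<open>p (k - 1)\<close> can therefore lie on a
  different side, which is why \<open>a\<close> and \<open>b\<close> stay below
  \<open>k - 1\<close>.\<close>

lemma pin_sequence_same_side:
  assumes "pin_sequence w p" "2 \<le> k" "k \<le> length w" "a < k - 1" "b < k - 1"
  shows "(fst (p a) < fst (p k) \<longleftrightarrow> fst (p b) < fst (p k)) \<and>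
         (fst (p k) < fst (p a) \<longleftrightarrow> fst (p k) < fst (p b)) \<and>
         (snd (p a) < snd (p k) \<longleftrightarrow> snd (p b) < snd (p k)) \<and>
         (snd (p k) < snd (p a) \<longleftrightarrow> snd (p k) < snd (p b))"
proof -
  obtain d where "\<forall>i < k. beyond d (p k) (p i)"
    and sep: "separates (other_coord d (p k)) (other_coord d (p (k - 1)))
                ((\<lambda>i. other_coord d (p i)) ` {..<k - 1})"
    using assms(1-3) unfolding pin_sequence_def by blast
  hence "beyond d (p k) (p a)" "beyond d (p k) (p b)" using assms(4,5) by auto
  moreover have "other_coord d (p a) < other_coord d (p k) \<and> other_coord d (p b) < other_coord d (p k) \<or>
      other_coord d (p k) < other_coord d (p a) \<and> other_coord d (p k) < other_coord d (p b)"
    using sep assms(4,5) unfolding separates_def by auto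
  ultimately show ?thesis by (cases d) auto
qed

text \<open>
  The numeral of the factor records the quadrant of \<open>p\<^sub>i\<close>, so that \<open>p\<^sub>i\<^sub>-\<^sub>1\<close> can be dropped although
  \<open>p\<^sub>i\<close> was placed relative to it.
\<close>

lemma pin_sequence_pin_factor:
  assumes "infinite_pin_word w" "pin_sequence (word_prefix w j) p" "2 \<le> i" "i \<le> j"
  shows "pin_sequence (pin_factor w i j) (\<lambda>k. if k = 0 then p 0 else p (i + k - 1))"
proof -
  define r where "r = (\<lambda>k. if k = 0 then p 0 else p (i + k - 1))"
  have ex1: "\<exists>!q. \<exists>p. pin_sequence (word_prefix w i) p \<and> in_quadrant q (p 0) (p i)"
    using assms by (intro ex1_pin_quadrant) auto
  then obtain q p' where p': "pin_sequence (word_prefix w i) p'" "in_quadrant q (p' 0) (p' i)"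
    by blast
  hence "pin_quadrant w i = q"
    unfolding pin_quadrant_def using ex1 by (intro the1_equality) auto
  \<comment> \<open>The quadrant was read off from \<open>p'\<close>; it is the same for
    \<open>p\<close> because pin sequences of one word are order-isomorphic.\<close>
  moreover have "in_quadrant q (p 0) (p i)"
  proof -
    have "finite_pin_word (word_prefix w i)" "pin_sequence (word_prefix w i) p"
      using assms pin_sequence_word_prefix by (auto simp: infinite_pin_word_def)
    note iso = pin_sequences_distinct_order_iso[OF this(1) p'(1) this(2), unfolded length_word_prefix]
    show ?thesis using p'(2) iso[of 0 i] iso[of i 0] by (cases q) auto
  qed
  ultimately have "\<exists>q. pin_factor w i j ! 0 = Num q \<and> in_quadrant q (r 0) (r 1)"
    using assms by (simp add: pin_factor_def r_def)
  moreover have "\<exists>d. pin_factor w i j ! (k - 1) = Dir d \<and>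
      (\<forall>l < k. beyond d (r k) (r l)) \<and>
      separates (other_coord d (r k)) (other_coord d (r (k - 1)))
        ((\<lambda>l. other_coord d (r l)) ` {..<k - 1})"
    if k: "2 \<le> k" "k \<le> length (pin_factor w i j)" for k
  proof -
    \<comment> \<open>\<open>K\<close> is the index in \<open>p\<close> of the pin
      \<open>r k\<close>; its letter is \<open>w (K - 1)\<close> because words are indexed from
      0.\<close>
    define K where "K = i + k - 1"
    have K: "2 \<le> K" "K \<le> j" "K - 1 < j" using assms k by (auto simp: K_def pin_factor_def)
    then obtain d where d: "w (K - 1) = Dir d" "\<forall>l < K. beyond d (p K) (p l)"
        "separates (other_coord d (p K)) (other_coord d (p (K - 1)))
           ((\<lambda>l. other_coord d (p l)) ` {..<K - 1})"
      using assms(2) unfolding pin_sequence_def by fastforce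
    have eq: "r k = p K" "r (k - 1) = p (K - 1)" using k by (auto simp: K_def r_def)
    \<comment> \<open>Separation from a set passes to its subsets, so dropping the pins between the
      origin and \<open>p i\<close> does no harm.\<close>
    have "(\<lambda>l. other_coord d (r l)) ` {..<k - 1} \<subseteq> (\<lambda>l. other_coord d (p l)) ` {..<K - 1}"
    proof (rule image_subsetI)
      fix l assume l: "l \<in> {..<k - 1}"
      define l' where "l' = (if l = 0 then 0 else i + l - 1)"
      have "r l = p l'" "l' < K - 1" using l k assms by (auto simp: l'_def K_def r_def)
      thus "other_coord d (r l) \<in> (\<lambda>l. other_coord d (p l)) ` {..<K - 1}" by simp
    qed
    hence "separates (other_coord d (r k)) (other_coord d (r (k - 1)))
        ((\<lambda>l. other_coord d (r l)) ` {..<k - 1})"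
      using d(3) unfolding eq separates_def by blast
    moreover have "beyond d (r k) (r l)" if "l < k" for l
      using d(2) that k assms unfolding eq by (auto simp: K_def r_def)
    moreover have "pin_factor w i j ! (k - 1) = w (K - 1)"
      using k K assms by (auto simp: pin_factor_def K_def nth_Cons' numeral_2_eq_2 add.commute)
    ultimately show ?thesis using d(1) by auto
  qed
  ultimately have "pin_sequence (pin_factor w i j) r" unfolding pin_sequence_def by blast
  thus ?thesis by (simp only: r_def)
qed

section \<open>Recurrence and closure under box sums\<close>

text \<open>Recurrence only gives infinitely many pairs. As the length of the factor is fixed at
  \<open>m\<close>, \<open>j\<close> is bounded in terms of \<open>i\<close>, so a bound on
  \<open>i\<close> would leave finitely many pairs.\<close>

lemma recurrent_prefix_recurs:
  assumes "recurrent w" "1 \<le> m"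
  obtains i j where "N \<le> i" "1 \<le> i" "i \<le> j" "pin_factor w i j = word_prefix w m"
proof -
  let ?A = "{(i, j). 1 \<le> i \<and> i \<le> j \<and> pin_factor w i j = word_prefix w m}"
  have "word_prefix w m = pin_factor w 1 m" by (simp add: pin_factor_def word_prefix_def)
  hence inf: "infinite ?A" using assms unfolding recurrent_def by auto
  have bound: "j < i + m" if "(i, j) \<in> ?A" for i j
  proof -
    have "length (pin_factor w i j) = m" using that by simp
    moreover have "length (pin_factor w i j) = Suc (j - i)"
      using that length_pin_factor[of i j w] by blast
    ultimately show ?thesis using that by auto
  qed
  have "\<exists>i j. (i, j) \<in> ?A \<and> N \<le> i"
  proof (rule ccontr)
    assume "\<not> ?thesis"
    hence "i < N" if "(i, j) \<in> ?A" for i j using that not_le by blast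
    hence "?A \<subseteq> {..<N} \<times> {..<N + m}" using bound by fastforce
    thus False using inf finite_subset by blast
  qed
  thus thesis using that by blast
qed

theorem corollary3p22:
  fixes w :: "nat \<Rightarrow> letter"
  assumes "infinite_pin_word w"
    and "recurrent w"
  shows "box_closed (centred_pin_class w)"
  unfolding box_closed_def
proof (intro conjI ballI)
  show "downward_closed (centred_pin_class w)"
    unfolding downward_closed_def centred_pin_class_def using contained_trans by blast
next
  fix \<pi> \<sigma> assume "\<pi> \<in> centred_pin_class w" "\<sigma> \<in> centred_pin_class w"
  then obtain n m where n: "1 \<le> n" "\<pi> \<preceq> pin_perm (word_prefix w n)"
    and m: "1 \<le> m" "\<sigma> \<preceq> pin_perm (word_prefix w m)"
    unfolding centred_pin_class_def by blast
  have fin: "finite_pin_word (word_prefix w k)" if "1 \<le> k" for k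
    using assms(1) that by (simp add: infinite_pin_word_def)
  \<comment> \<open>The gap \<open>n + 2\<close> ensures \<open>a < k - 1\<close> for all
    \<open>a \<le> n\<close> and \<open>k \<ge> i\<close>, as \<open>pin_sequence_same_side\<close>
    requires.\<close>
  obtain i j where ij: "n + 2 \<le> i" "i \<le> j" "pin_factor w i j = word_prefix w m"
    using recurrent_prefix_recurs[OF assms(2) m(1)] by metis
  have len: "m = Suc (j - i)"
    using ij length_pin_factor[of i j w] by simp
  obtain p where p: "pin_sequence (word_prefix w j) p"
    using ex_pin_sequence[OF fin, of j] ij by auto
  \<comment> \<open>The origin followed by the pins \<open>p i\<close> to \<open>p j\<close>: by the
    choice of \<open>i\<close> and \<open>j\<close>, a pin sequence for the prefix of length
    \<open>m\<close>, inside the same point set as the block.\<close>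
  define q where "q = (\<lambda>k. if k = 0 then p 0 else p (i + k - 1))"
  have "pin_sequence (word_prefix w n) p" using pin_sequence_word_prefix[OF p n(1)] ij by simp
  hence \<pi>: "embeds \<pi> (p ` {..n}) (p 0)"
    using contained_iff_embeds[OF represents_pin_perm[OF fin[OF n(1)]]] n(2) by simp
  have "pin_sequence (word_prefix w m) q"
    using pin_sequence_pin_factor[OF assms(1) p _ ij(2)] ij unfolding q_def by simp
  hence \<sigma>: "embeds \<sigma> (q ` {..m}) (p 0)"
    using contained_iff_embeds[OF represents_pin_perm[OF fin[OF m(1)]]] m(2) by (simp add: q_def)
  have "embeds (\<pi> \<boxplus> \<sigma>) (p ` {..n} \<union> q ` {..m}) (p 0)"
  proof (rule embeds_box_sum[OF \<pi> \<sigma>])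
    fix s t assume s: "s \<in> p ` {..n}" and t: "t \<in> q ` {..m}" "t \<noteq> p 0"
    obtain a where a: "a \<le> n" "s = p a" using s by blast
    obtain l where l: "l \<le> m" "t = q l" using t(1) by blast
    define k where "k = i + l - 1"
    have "l \<noteq> 0" using l t(2) by (cases "l = 0") (auto simp: q_def)
    hence k: "i \<le> k" "k \<le> j" "t = p k" using l ij len by (auto simp: q_def k_def)
    show "(fst s < fst t \<longleftrightarrow> fst (p 0) < fst t) \<and> (fst t < fst s \<longleftrightarrow> fst t < fst (p 0)) \<and>
       (snd s < snd t \<longleftrightarrow> snd (p 0) < snd t) \<and> (snd t < snd s \<longleftrightarrow> snd t < snd (p 0))"
      using pin_sequence_same_side[OF p, of k a 0] a k ij by simp
  qed
  moreover have "p ` {..n} \<union> q ` {..m} \<subseteq> p ` {..j}" using ij len by (auto simp: q_def)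
  ultimately have "embeds (\<pi> \<boxplus> \<sigma>) (p ` {..j}) (p 0)" by (rule embeds_mono)
  moreover have "1 \<le> j" using ij by simp
  ultimately have "\<pi> \<boxplus> \<sigma> \<preceq> pin_perm (word_prefix w j)"
    using contained_iff_embeds[OF represents_pin_perm[OF fin p]] by simp
  thus "\<pi> \<boxplus> \<sigma> \<in> centred_pin_class w"
    unfolding centred_pin_class_def using \<open>1 \<le> j\<close> by blast
qed

end
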